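(* Let $\mathcal{X}\subset\mathbb{R}^n$ be a convex set, $p>1$, $\tau\in(0,1)$, and let $F:\mathbb{R}^n\to\mathbb{R}^n$ satisfy $\|\nabla^{p-1}F(x)-\nabla^{p-1}F(y)\|\le L_p\|x-y\|$, with $\mathrm{VI}_{\mathcal{X}}(F(x))\ne\emptyset$. Let $\{x^k\}_{k\ge1}$ and $\{x^{k+0.5}\}_{k\ge1}$ be generated by the algorithm "ARE-Restart with Local Superlinear Convergence" described in the context. Suppose that $F$ is strongly monotone with modulus $\mu>0$, let $x^*$ be the unique element of $\mathrm{VI}_{\mathcal{X}}(F(x))$, and suppose that $\tilde F(\cdot\,;x^k)$ is such that the bound $\|\tilde F(x;y)-F(x)\|\le\tau L_p\|x-y\|^p$ holds (with $y=x^k$). Then the total iteration complexity to reach $\|x^k-x^*\|\le\epsilon$ for some $\epsilon>0$ is $$\tilde{\mathcal{O}}\left(\left(\frac{L_p}{\mu}\right)^{\frac{2}{p+1}}(D^2)^{\frac{p-1}{p+1}}+\log_p\log_2\frac1\epsilon\right),$$ where $\tilde{\mathcal{O}}$ suppresses the logarithmic part in the first term.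
   Context: $\|\cdot\|$ is the Euclidean norm (and the corresponding norm for derivative tensors); $\nabla^{p-1}F$ is the $(p-1)$-th derivative of $F$. For a mapping $T:\mathbb{R}^n\to\mathbb{R}^n$, $\mathrm{VI}_{\mathcal{X}}(T(x)):=\{x^*\in\mathcal{X}\mid\langle T(x^* ),x-x^*\rangle\ge0\ \text{for all }x\in\mathcal{X}\}$. $F$ is strongly monotone with modulus $\mu>0$ if $\langle F(x)-F(y),x-y\rangle\ge\mu\|x-y\|^2$ for all $x,y\in\mathcal{X}$. For each $y\in\mathcal{X}$, $\tilde F(\cdot\,;y):\mathbb{R}^n\to\mathbb{R}^n$ is an approximation of $F$ at $y$. Algorithm "ARE-Restart with Local Superlinear Convergence" (ARE = Approximation-based Regularized Extra-gradient method). Input: $x^1\in\mathcal{X}$, $0<\alpha<1$, $D\ge\|x^1-x^*\|$, and an inner iteration number $$N=\left\lceil\left(\frac{L_p}{\mu}\right)^{\frac{2}{p+1}}\left(\frac{D^2}{1-\tau^2}\right)^{\frac{p-1}{p+1}}\right\rceil.$$ Step 0: set $k:=1$. Step 1: let $x^{k+0.5}$ be any element of $\mathrm{VI}_{\mathcal{X}}\left(\tilde F(x;x^k)+L_p\|x-x^k\|^{p-1}(x-x^k)\right)$ (with $x$ the variable and $x^k$ fixed). If $$\|x^{k+0.5}-x^k\|^{p-1}\le\frac{\alpha\sqrt{1-\tau^2}}{1+\tau}\,\frac{\mu}{L_p},$$ then set $x^{k+1}:=x^{k+0.5}$, set $k:=k+1$, and return to Step 1. Otherwise go to Step 2. Step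 2: let $x^{k+1}:=\arg\min_{x\in\mathcal{X}}\langle F(x^{k+0.5}),x-x^k\rangle+\frac{\gamma_k}{2}\|x-x^k\|^2$ with $\gamma_k:=L_p\|x^{k+0.5}-x^k\|^{p-1}$. If $k=N$, let $\Gamma_N:=\sum_{k=1}^N\frac1{\gamma_k}$ and $\bar x_N:=\Gamma_N^{-1}\sum_{k=1}^N\frac1{\gamma_k}x^{k+0.5}$, set $x^1:=\bar x_N$, and return to Step 0. Otherwise set $k:=k+1$ and return to Step 1.
   Formalization: The bound is proved for ε ≤ min(1/4, (L_p/μ)^{1/(p-1)}); for larger ε no constant independent of L_p, μ works (e.g. F(x)=μx, p=2, D=μ/(10L_p), ε=1/4, μ/L_p→∞), and log log(1/ε) is undefined for ε ≥ 1. *)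

theory Defs
  imports "HOL-Analysis.Analysis"
begin

definition VI :: "'a::real_inner set \<Rightarrow> ('a \<Rightarrow> 'a) \<Rightarrow> 'a set" where
  "VI X T = {z \<in> X. \<forall>x\<in>X. 0 \<le> T z \<bullet> (x - z)}"

definition strongly_monotone_on :: "'a::real_inner set \<Rightarrow> real \<Rightarrow> ('a \<Rightarrow> 'a) \<Rightarrow> bool" where
  "strongly_monotone_on X \<mu> F \<longleftrightarrow>
     (\<forall>x\<in>X. \<forall>y\<in>X. \<mu> * (norm (x - y))\<^sup>2 \<le> (F x - F y) \<bullet> (x - y))"

text \<open>
  Higher derivatives as multilinear maps: for \<open>length vs = m\<close>, \<open>iter_deriv F vs x\<close> is the
  \<open>m\<close>-th derivative tensor of \<open>F\<close> at \<open>x\<close> applied to the directions \<open>vs\<close>.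
\<close>

primrec iter_deriv ::
  "('a::real_normed_vector \<Rightarrow> 'b::real_normed_vector) \<Rightarrow> 'a list \<Rightarrow> 'a \<Rightarrow> 'b" where
  "iter_deriv F [] = F"
| "iter_deriv F (v # vs) = (\<lambda>x. frechet_derivative (iter_deriv F vs) (at x) v)"

text \<open>
  On a finite-dimensional space a derivative tensor is differentiable iff all its evaluations
  are, so the following is ordinary \<open>m\<close>-fold Frechet differentiability on the whole space.
\<close>

definition times_differentiable ::
  "nat \<Rightarrow> ('a::euclidean_space \<Rightarrow> 'b::euclidean_space) \<Rightarrow> bool" where
  "times_differentiable m F \<longleftrightarrow>
     (\<forall>vs x. length vs < m \<longrightarrow> iter_deriv F vs differentiable (at x))"

text \<open>
  Operator norm of an \<open>m\<close>-linear map; the supremum is finite since multilinear maps on a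
  finite-dimensional space are bounded.
\<close>

definition tensor_norm ::
  "nat \<Rightarrow> ('a::euclidean_space list \<Rightarrow> 'b::euclidean_space) \<Rightarrow> real" where
  "tensor_norm m T = (SUP vs\<in>{vs. length vs = m \<and> (\<forall>v\<in>set vs. norm v \<le> 1)}. norm (T vs))"

definition inner_iterations :: "nat \<Rightarrow> real \<Rightarrow> real \<Rightarrow> real \<Rightarrow> real \<Rightarrow> nat" where
  "inner_iterations p \<tau> L \<mu> D =
     nat \<lceil>(L / \<mu>) powr (2 / (real p + 1))
           * (D\<^sup>2 / (1 - \<tau>\<^sup>2)) powr ((real p - 1) / (real p + 1))\<rceil>"

text \<open>
  An infinite run of the restarted method, indexed by the total number \<open>t\<close> of passes through
  Step 1 made so far, over all restarts.  In pass \<open>t\<close> the inner counter is \<open>k t\<close>, and \<open>x t\<close>, \<open>h t\<close>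
  are the points written \<open>x\<^sup>k\<close>, \<open>x\<^sup>k\<^sup>+\<^sup>0\<^sup>.\<^sup>5\<close> for \<open>k = k t\<close>.  The point \<open>y t\<close> is the minimizer computed
  in Step 2; it is unconstrained in passes that do not reach Step 2, and it is discarded
  when a restart takes place.  The counter increases by one from pass to pass, so when
  \<open>k t = N\<close> the passes of the current epoch are exactly \<open>t + 1 - N, \<dots>, t\<close>.  \<open>Ft z y\<close> is the
  approximation at \<open>y\<close>, evaluated at \<open>z\<close>.
\<close>

definition are_restart_run ::
  "'a::real_inner set \<Rightarrow> ('a \<Rightarrow> 'a) \<Rightarrow> ('a \<Rightarrow> 'a \<Rightarrow> 'a) \<Rightarrow> nat \<Rightarrow> real \<Rightarrow> real \<Rightarrow> real \<Rightarrow> real \<Rightarrow> real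
     \<Rightarrow> (nat \<Rightarrow> nat) \<Rightarrow> (nat \<Rightarrow> 'a) \<Rightarrow> (nat \<Rightarrow> 'a) \<Rightarrow> (nat \<Rightarrow> 'a) \<Rightarrow> bool" where
  "are_restart_run X F Ft p \<tau> \<alpha> L \<mu> D k x h y \<longleftrightarrow>
     (let N = inner_iterations p \<tau> L \<mu> D;
          \<gamma> = (\<lambda>t. L * norm (h t - x t) ^ (p - 1))
      in
        x 0 \<in> X \<and> k 0 = 1 \<and>
        (\<forall>t. h t \<in> VI X (\<lambda>z. Ft z (x t) + (L * norm (z - x t) ^ (p - 1)) *\<^sub>R (z - x t)) \<and>
          (if norm (h t - x t) ^ (p - 1) \<le> \<alpha> * sqrt (1 - \<tau>\<^sup>2) / (1 + \<tau>) * (\<mu> / L)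
           then x (Suc t) = h t \<and> k (Suc t) = k t + 1
           else
             is_arg_min (\<lambda>z. F (h t) \<bullet> (z - x t) + \<gamma> t / 2 * (norm (z - x t))\<^sup>2)
               (\<lambda>z. z \<in> X) (y t) \<and>
             (if k t = N
              then x (Suc t) =
                     (1 / (\<Sum>s\<in>{t + 1 - N..t}. 1 / \<gamma> s)) *\<^sub>R
                     (\<Sum>s\<in>{t + 1 - N..t}. (1 / \<gamma> s) *\<^sub>R h s) \<and>
                   k (Suc t) = 1
              else x (Suc t) = y t \<and> k (Suc t) = k t + 1))))"

definition first_term :: "nat \<Rightarrow> real \<Rightarrow> real \<Rightarrow> real \<Rightarrow> real" where
  "first_term p L \<mu> D =
     (L / \<mu>) powr (2 / (real p + 1)) * (D\<^sup>2) powr ((real p - 1) / (real p + 1))"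

text \<open>
  The factor hidden by the O-symbol.  It may depend on \<open>p\<close>, \<open>\<tau>\<close>, \<open>\<alpha>\<close> only.  The dimension of
  the space is a type, so an existentially quantified factor could depend on it; a closed
  term cannot.  The particular value has no significance.
\<close>

definition complexity_factor :: "nat \<Rightarrow> real \<Rightarrow> real \<Rightarrow> real" where
  "complexity_factor p \<tau> \<alpha> = 100 * (real p)\<^sup>2 / (\<alpha> * (1 - \<alpha>) * (1 - \<tau>\<^sup>2)\<^sup>2)"

text \<open>
  The soft-O bound, \<open>A\<close> being the first term: the suppressed logarithm is that of \<open>A\<close> itself,
  and the term in \<open>\<epsilon>\<close> carries no suppressed factor.
\<close>

definition soft_complexity_bound ::
  "nat \<Rightarrow> real \<Rightarrow> real \<Rightarrow> real \<Rightarrow> real \<Rightarrow> real \<Rightarrow> real \<Rightarrow> real" where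
  "soft_complexity_bound p \<tau> \<alpha> L \<mu> D \<epsilon> =
     (let A = first_term p L \<mu> D
      in complexity_factor p \<tau> \<alpha> * (A * log 2 (2 + A) + log (real p) (log 2 (1 / \<epsilon>))))"

end

theory Submission
  imports Defs
begin

text \<open>
  Write \<open>d\<close>, \<open>r\<close>, \<open>e\<close> for the distances from \<open>x\<close> to the solution, from \<open>h\<close> to \<open>x\<close> and from \<open>h\<close> to the
  solution, and \<open>\<sigma> = 1 - \<tau>\<^sup>2\<close>.  Every pass satisfies \<open>\<sigma> r\<^sup>2 \<le> d\<^sup>2\<close> and
  \<open>e \<le> (1 + \<tau>) (L / \<mu>) r\<^sup>p\<close>.  After a local pass \<open>d\<close> becomes \<open>e\<close>, so the next \<open>r\<close> is at most
  \<open>c r\<^sup>p\<close>; hence local passes are followed only by local passes, and they converge with order \<open>p\<close>.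
  Before the first local pass the run is a plain restarted extragradient method: in one epoch the
  squares of the \<open>r\<close> have sum at most \<open>d\<^sup>2 / \<sigma>\<close>, so by convexity of \<open>u powr (- (p - 1) / 2)\<close> in \<open>u\<close>
  the weights \<open>1 / \<gamma>\<close> have sum at least \<open>1 / \<mu>\<close>, and the averaged point has at most half the
  squared distance.  Since \<open>r\<close> is controlled by \<open>d\<close>, a local pass occurs after a number of
  epochs logarithmic in \<open>N\<close>.
\<close>

section \<open>Inequalities in inner product spaces and for real powers\<close>

text \<open>The three-point identity expresses \<open>(u - v) \<bullet> (z - u)\<close> through
  squared distances, which later cancel between inequalities or telescope.\<close>

lemma regularized_VI_inner_le:
  fixes u v z G :: "'a::real_inner"
  assumes "0 \<le> (G + g *\<^sub>R (u - v)) \<bullet> (z - u)"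
  shows "G \<bullet> (u - z) \<le> g / 2 * ((norm (z - v))\<^sup>2 - (norm (u - v))\<^sup>2 - (norm (z - u))\<^sup>2)"
proof -
  have "(norm (z - v))\<^sup>2 - (norm (u - v))\<^sup>2 - (norm (z - u))\<^sup>2 = 2 * ((u - v) \<bullet> (z - u))"
    by (simp add: power2_norm_eq_inner algebra_simps inner_commute)
  moreover have "G \<bullet> (u - z) \<le> g * ((u - v) \<bullet> (z - u))"
    using assms by (simp add: inner_add_left inner_diff_right right_diff_distrib)
  ultimately show ?thesis by simp
qed

text \<open>Used with \<open>b\<close> equal to \<tau> times the step: the term in \<open>w\<close>
  cancels exactly against a square from the three-point identity, and \<tau> squared lowers the
  coefficient of the squared step from 1 to \<sigma>.\<close>

lemma inner_le_young:
  fixes E w :: "'a::real_inner"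
  assumes "norm E \<le> g * b" "0 \<le> g"
  shows "E \<bullet> w \<le> g / 2 * (b\<^sup>2 + (norm w)\<^sup>2)"
proof -
  have "E \<bullet> w \<le> g * b * norm w"
    using assms(1) norm_cauchy_schwarz[of E w] mult_right_mono[OF assms(1), of "norm w"] by simp
  also have "\<dots> = g * (b * norm w)" by simp
  also have "\<dots> \<le> g * ((b\<^sup>2 + (norm w)\<^sup>2) / 2)"
    using sum_squares_bound[of b "norm w"] assms(2) by (intro mult_left_mono) auto
  finally show ?thesis by simp
qed

text \<open>First-order optimality without derivatives: moving from \<open>u\<close> by a fraction
  \<open>s\<close> towards \<open>z\<close> changes the objective by
  \<open>s * q + s\<^sup>2 * Q\<close>, which is negative for small \<open>s\<close> if
  \<open>q\<close> is.\<close>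

lemma arg_min_quadratic_VI:
  fixes a v u z :: "'a::real_inner"
  assumes "convex X"
    and min: "is_arg_min (\<lambda>z. a \<bullet> (z - v) + g / 2 * (norm (z - v))\<^sup>2) (\<lambda>z. z \<in> X) u"
    and "z \<in> X"
  shows "0 \<le> (a + g *\<^sub>R (u - v)) \<bullet> (z - u)"
proof (rule ccontr)
  define q where "q = (a + g *\<^sub>R (u - v)) \<bullet> (z - u)"
  define Q where "Q = g / 2 * (norm (z - u))\<^sup>2"
  assume "\<not> 0 \<le> (a + g *\<^sub>R (u - v)) \<bullet> (z - u)"
  then have "q < 0" by (simp add: q_def)
  have "u \<in> X" using min by (simp add: is_arg_min_def)
  have ge: "0 \<le> s * q + s\<^sup>2 * Q" if "0 \<le> s" "s \<le> 1" for s
  proof -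
    have "u + s *\<^sub>R (z - u) = (1 - s) *\<^sub>R u + s *\<^sub>R z" by (simp add: algebra_simps)
    then have "u + s *\<^sub>R (z - u) \<in> X"
      using convexD[OF \<open>convex X\<close> \<open>u \<in> X\<close> \<open>z \<in> X\<close>, of "1 - s" s] that by simp
    then have "a \<bullet> (u - v) + g / 2 * (norm (u - v))\<^sup>2
        \<le> a \<bullet> (u + s *\<^sub>R (z - u) - v) + g / 2 * (norm (u + s *\<^sub>R (z - u) - v))\<^sup>2"
      using min unfolding is_arg_min_linorder by blast
    moreover have "(norm (u + s *\<^sub>R (z - u) - v))\<^sup>2
        = (norm (u - v))\<^sup>2 + 2 * s * ((u - v) \<bullet> (z - u)) + s\<^sup>2 * (norm (z - u))\<^sup>2"
      unfolding power2_norm_eq_inner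
      by (simp add: algebra_simps inner_commute power2_eq_square)
    moreover have "a \<bullet> (u + s *\<^sub>R (z - u) - v) = a \<bullet> (u - v) + s * (a \<bullet> (z - u))"
      by (simp add: algebra_simps)
    ultimately have "0 \<le> s * (a \<bullet> (z - u)) + g / 2 * (2 * s * ((u - v) \<bullet> (z - u)) + s\<^sup>2 * (norm (z - u))\<^sup>2)"
      by (simp add: distrib_left)
    then show ?thesis
      by (simp add: q_def Q_def inner_add_left distrib_left mult_ac)
  qed
  \<comment> \<open>Small enough that the quadratic term uses at most half of the linear decrease;
    the added 1 covers \<open>Q = 0\<close>, and the minimum keeps the point on the segment.\<close>
  define s where "s = min 1 (- q / (2 * (\<bar>Q\<bar> + 1)))"
  have s: "0 < s" "s \<le> 1" using \<open>q < 0\<close> by (auto simp: s_def divide_neg_pos)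
  have "s * (\<bar>Q\<bar> + 1) \<le> - q / (2 * (\<bar>Q\<bar> + 1)) * (\<bar>Q\<bar> + 1)"
    unfolding s_def by (intro mult_right_mono) auto
  also have "\<dots> = - q / 2" by (simp add: field_simps)
  finally have "s * \<bar>Q\<bar> \<le> - q / 2" using s by (simp add: algebra_simps)
  moreover have "s * Q \<le> s * \<bar>Q\<bar>" using s by simp
  ultimately have "q + s * Q < 0" using \<open>q < 0\<close> by linarith
  then have "s * (q + s * Q) < 0" using s by (simp add: mult_pos_neg)
  with ge[of s] s show False by (simp add: algebra_simps power2_eq_square)
qed

lemma norm_weighted_mean_le:
  fixes f :: "'b \<Rightarrow> 'a::real_inner"
  assumes "finite S" "\<And>s. s \<in> S \<Longrightarrow> 0 < w s" "S \<noteq> {}"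
  shows "sum w S * (norm ((1 / sum w S) *\<^sub>R (\<Sum>s\<in>S. w s *\<^sub>R f s) - c))\<^sup>2
    \<le> (\<Sum>s\<in>S. w s * (norm (f s - c))\<^sup>2)"
proof -
  define W where "W = sum w S"
  define v where "v = (1 / W) *\<^sub>R (\<Sum>s\<in>S. w s *\<^sub>R f s) - c"
  have "0 < W" unfolding W_def using assms by (intro sum_pos) auto
  have mean: "(\<Sum>s\<in>S. w s *\<^sub>R (f s - c)) = W *\<^sub>R v"
    using \<open>0 < W\<close> by (simp add: v_def W_def algebra_simps sum_subtractf scaleR_left.sum)
  \<comment> \<open>The weighted variance about the mean is nonnegative; expanding it gives Jensen's
    inequality for the squared norm.\<close>
  have "0 \<le> (\<Sum>s\<in>S. w s * (norm (f s - c - v))\<^sup>2)"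
    using assms by (intro sum_nonneg mult_nonneg_nonneg) (auto simp: less_imp_le)
  also have "\<dots> = (\<Sum>s\<in>S. w s * (norm (f s - c))\<^sup>2 - 2 * ((w s *\<^sub>R (f s - c)) \<bullet> v) + w s * (norm v)\<^sup>2)"
    unfolding power2_norm_eq_inner
    by (intro sum.cong) (simp_all add: algebra_simps inner_commute)
  also have "\<dots> = (\<Sum>s\<in>S. w s * (norm (f s - c))\<^sup>2) - 2 * ((\<Sum>s\<in>S. w s *\<^sub>R (f s - c)) \<bullet> v)
      + W * (norm v)\<^sup>2"
    by (simp add: sum.distrib sum_subtractf sum_distrib_left inner_sum_left sum_distrib_right W_def)
  also have "(\<Sum>s\<in>S. w s *\<^sub>R (f s - c)) \<bullet> v = W * (norm v)\<^sup>2"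
    unfolding mean by (simp add: power2_norm_eq_inner)
  finally show ?thesis by (simp add: v_def W_def)
qed

text \<open>A convex function lies above its tangent at \<open>c\<close>. The tangents have slope at
  most 0 and the mean of \<open>u\<close> is at most \<open>c\<close>, so summing them can only gain
  from the linear terms.\<close>

lemma power_mean_negative_exponent:
  fixes u :: "'b \<Rightarrow> real"
  assumes "finite S" "\<And>s. s \<in> S \<Longrightarrow> 0 < u s" "sum u S \<le> real (card S) * c" "0 < c" "0 \<le> a"
  shows "real (card S) * c powr (- a) \<le> (\<Sum>s\<in>S. u s powr (- a))"
proof -
  have tangent: "c powr (- a) * (1 - a * (u s / c - 1)) \<le> u s powr (- a)" if "s \<in> S" for s
  proof -
    have pos: "0 < u s / c" using assms that by simp
    have "1 - a * (u s / c - 1) \<le> 1 + - a * ln (u s / c)"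
      using ln_le_minus_one[OF pos] \<open>0 \<le> a\<close> mult_left_mono by fastforce
    also have "\<dots> \<le> exp (- a * ln (u s / c))" by (rule exp_ge_add_one_self)
    also have "\<dots> = (u s / c) powr (- a)" using pos by (auto simp: powr_def)
    finally have "c powr (- a) * (1 - a * (u s / c - 1)) \<le> c powr (- a) * (u s / c) powr (- a)"
      by (intro mult_left_mono) auto
    also have "\<dots> = u s powr (- a)"
      using \<open>0 < c\<close> assms(2)[OF that] by (simp add: powr_mult[symmetric])
    finally show ?thesis .
  qed
  have "real (card S) * c powr (- a)
      \<le> c powr (- a) * (real (card S) - a * (sum u S / c - real (card S)))"
  proof -
    have "sum u S / c - real (card S) \<le> 0" using assms by (simp add: field_simps)
    then have "a * (sum u S / c - real (card S)) \<le> 0" using \<open>0 \<le> a\<close> by (simp add: mult_nonneg_nonpos)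
    then have "real (card S) \<le> real (card S) - a * (sum u S / c - real (card S))" by linarith
    then have "c powr (- a) * real (card S)
        \<le> c powr (- a) * (real (card S) - a * (sum u S / c - real (card S)))"
      by (intro mult_left_mono) auto
    then show ?thesis by (simp add: mult.commute)
  qed
  also have "\<dots> = (\<Sum>s\<in>S. c powr (- a) * (1 - a * (u s / c - 1)))"
    by (simp add: sum_distrib_left[symmetric] sum_subtractf sum_divide_distrib)
  also have "\<dots> \<le> (\<Sum>s\<in>S. u s powr (- a))" by (intro sum_mono tangent)
  finally show ?thesis .
qed

lemma log_le_self:
  fixes b z :: real
  assumes "2 \<le> b" "1 \<le> z"
  shows "log b z \<le> z"
proof -
  have ln2: "1 / 2 \<le> ln (2::real)" "ln (2::real) \<le> 1"
    using ln2_ge_two_thirds ln_le_minus_one[of "2::real"] by linarith+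
  \<comment> \<open>Halving the argument improves \<open>ln z \<le> z - 1\<close> to
    \<open>ln z \<le> z / 2\<close>, which is enough because \<open>ln b\<close> is at least
    1/2.\<close>
  have "ln z = ln (z / 2) + ln 2" using assms by (simp add: ln_div)
  also have "\<dots> \<le> z * (1 / 2)" using ln_le_minus_one[of "z / 2"] assms ln2 by simp
  also have "\<dots> \<le> z * ln b"
  proof (intro mult_left_mono)
    have "ln 2 \<le> ln b" using assms by simp
    then show "1 / 2 \<le> ln b" using ln2 by linarith
  qed (use assms in simp)
  finally show ?thesis using assms by (simp add: log_def pos_divide_le_eq)
qed

section \<open>Quantities attached to a run and the transitions of one pass\<close>

locale restart_run =
  fixes X :: "'a::real_inner set" and F :: "'a \<Rightarrow> 'a" and Ft :: "'a \<Rightarrow> 'a \<Rightarrow> 'a"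
    and p :: nat and \<tau> \<alpha> L \<mu> D :: real and xs :: 'a
    and k :: "nat \<Rightarrow> nat" and x h y :: "nat \<Rightarrow> 'a"
  assumes convex: "convex X"
    and p: "p > 1" and \<tau>: "0 < \<tau>" "\<tau> < 1" and \<alpha>: "0 < \<alpha>" "\<alpha> < 1" and L: "L > 0" and \<mu>: "\<mu> > 0"
    and strongly_monotone: "strongly_monotone_on X \<mu> F"
    and solution: "xs \<in> VI X F"
    and run: "are_restart_run X F Ft p \<tau> \<alpha> L \<mu> D k x h y"
    and start: "norm (x 0 - xs) \<le> D"
    and approx: "\<And>t z. z \<in> X \<Longrightarrow> norm (Ft z (x t) - F z) \<le> \<tau> * L * norm (z - x t) ^ p"
begin

definition r :: "nat \<Rightarrow> real" where "r t = norm (h t - x t)"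
definition d :: "nat \<Rightarrow> real" where "d t = norm (x t - xs)"
definition e :: "nat \<Rightarrow> real" where "e t = norm (h t - xs)"
definition \<sigma> :: real where "\<sigma> = 1 - \<tau>\<^sup>2"
definition \<gamma> :: "nat \<Rightarrow> real" where "\<gamma> t = L * r t ^ (p - 1)"
text \<open>The scaling that normalizes the local phase: for \<open>u = c * r t ^ (p - 1)\<close>
  the test in Step 1 reads \<open>u \<le> \<alpha>\<close>, and a local pass sends \<open>u\<close>
  to at most \<open>u ^ p\<close>.\<close>

definition c :: real where "c = (1 + \<tau>) / sqrt \<sigma> * (L / \<mu>)"
definition N :: nat where "N = inner_iterations p \<tau> L \<mu> D"
definition is_local :: "nat \<Rightarrow> bool" where "is_local t \<longleftrightarrow> c * r t ^ (p - 1) \<le> \<alpha>"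

lemma \<sigma>: "0 < \<sigma>" "\<sigma> < 1"
  using \<tau> by (auto simp: \<sigma>_def power_less_one_iff abs_square_less_1)

lemma c_pos: "0 < c"
  using \<sigma> \<tau> L \<mu> by (simp add: c_def)

lemma r_power: "r t ^ p = r t ^ (p - 1) * r t"
  using p by (metis One_nat_def Suc_pred mult.commute not_gr0 not_less_zero power_Suc)

lemma \<gamma>_nonneg: "0 \<le> \<gamma> t"
  using L by (simp add: \<gamma>_def r_def)

lemma is_local_iff:
  "is_local t \<longleftrightarrow> norm (h t - x t) ^ (p - 1) \<le> \<alpha> * sqrt (1 - \<tau>\<^sup>2) / (1 + \<tau>) * (\<mu> / L)"
proof -
  have "\<alpha> * sqrt \<sigma> / (1 + \<tau>) * (\<mu> / L) = \<alpha> / c"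
    using \<sigma> \<tau> L \<mu> by (simp add: c_def)
  then show ?thesis
    using c_pos by (simp add: is_local_def r_def \<sigma>_def[symmetric] pos_le_divide_eq mult.commute)
qed

lemma xs_in: "xs \<in> X" and xs_VI: "z \<in> X \<Longrightarrow> 0 \<le> F xs \<bullet> (z - xs)"
  using solution by (auto simp: VI_def)

lemma h_in: "h t \<in> X"
  and h_VI: "z \<in> X \<Longrightarrow> 0 \<le> (Ft (h t) (x t) + \<gamma> t *\<^sub>R (h t - x t)) \<bullet> (z - h t)"
  using run by (auto simp: are_restart_run_def VI_def Let_def \<gamma>_def r_def)

lemma k_0: "k 0 = 1"
  using run by (simp add: are_restart_run_def Let_def)

lemma local_step: "is_local t \<Longrightarrow> x (Suc t) = h t"
  using run by (simp add: are_restart_run_def Let_def is_local_iff)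

lemma nonlocal_step:
  assumes "\<not> is_local t"
  shows "is_arg_min (\<lambda>z. F (h t) \<bullet> (z - x t) + \<gamma> t / 2 * (norm (z - x t))\<^sup>2) (\<lambda>z. z \<in> X) (y t)"
    and "k t = N \<Longrightarrow> x (Suc t) = (1 / (\<Sum>s\<in>{t + 1 - N..t}. 1 / \<gamma> s)) *\<^sub>R
      (\<Sum>s\<in>{t + 1 - N..t}. (1 / \<gamma> s) *\<^sub>R h s)"
    and "k t = N \<Longrightarrow> k (Suc t) = 1"
    and "k t \<noteq> N \<Longrightarrow> x (Suc t) = y t"
    and "k t \<noteq> N \<Longrightarrow> k (Suc t) = k t + 1"
proof -
  have "if is_local t then x (Suc t) = h t \<and> k (Suc t) = k t + 1
      else is_arg_min (\<lambda>z. F (h t) \<bullet> (z - x t) + \<gamma> t / 2 * (norm (z - x t))\<^sup>2) (\<lambda>z. z \<in> X) (y t) \<and>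
        (if k t = N
         then x (Suc t) = (1 / (\<Sum>s\<in>{t + 1 - N..t}. 1 / \<gamma> s)) *\<^sub>R
             (\<Sum>s\<in>{t + 1 - N..t}. (1 / \<gamma> s) *\<^sub>R h s) \<and> k (Suc t) = 1
         else x (Suc t) = y t \<and> k (Suc t) = k t + 1)"
    using run unfolding are_restart_run_def Let_def is_local_iff N_def \<gamma>_def r_def
    by (elim conjE allE[of _ t])
  note this[unfolded if_not_P[OF assms]]
  then show "is_arg_min (\<lambda>z. F (h t) \<bullet> (z - x t) + \<gamma> t / 2 * (norm (z - x t))\<^sup>2) (\<lambda>z. z \<in> X) (y t)"
    and "k t = N \<Longrightarrow> x (Suc t) = (1 / (\<Sum>s\<in>{t + 1 - N..t}. 1 / \<gamma> s)) *\<^sub>R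
      (\<Sum>s\<in>{t + 1 - N..t}. (1 / \<gamma> s) *\<^sub>R h s)"
    and "k t = N \<Longrightarrow> k (Suc t) = 1"
    and "k t \<noteq> N \<Longrightarrow> x (Suc t) = y t"
    and "k t \<noteq> N \<Longrightarrow> k (Suc t) = k t + 1"
    by simp_all
qed

text \<open>A zero step would pass the local test, since \<open>p > 1\<close> makes its power
  vanish. Hence the weights in an averaged point are genuine positive numbers.\<close>

lemma nonlocal_pos:
  assumes "\<not> is_local t"
  shows "0 < r t" "0 < \<gamma> t"
proof -
  have "r t \<noteq> 0" using assms p \<alpha> by (auto simp: is_local_def power_0_left)
  then show "0 < r t" by (simp add: r_def)
  then show "0 < \<gamma> t" using L by (simp add: \<gamma>_def)
qed

section \<open>Distance estimates valid in every pass\<close>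

lemma growth: "\<mu> * (e t)\<^sup>2 \<le> F (h t) \<bullet> (h t - xs)"
proof -
  have "\<mu> * (norm (h t - xs))\<^sup>2 \<le> (F (h t) - F xs) \<bullet> (h t - xs)"
    using strongly_monotone h_in xs_in by (auto simp: strongly_monotone_on_def)
  with xs_VI[OF h_in, of t] show ?thesis by (simp add: e_def inner_diff_left)
qed

lemma approx_h: "norm (F (h t) - Ft (h t) (x t)) \<le> \<gamma> t * (\<tau> * r t)"
  using approx[OF h_in, of t t] r_power[of t]
  by (simp add: norm_minus_commute \<gamma>_def r_def mult_ac)

text \<open>Adding the three-point bound and the Young bound for the approximation error cancels the
  squares of \<open>e t\<close>; what remains is at least \<open>\<mu> * (e t)\<^sup>2\<close>,
  hence nonnegative.\<close>

lemma r_le_d: "sqrt \<sigma> * r t \<le> d t"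
proof (cases "r t = 0")
  case False
  have g: "0 < \<gamma> t" using False L by (simp add: \<gamma>_def r_def)
  have "Ft (h t) (x t) \<bullet> (h t - xs) \<le> \<gamma> t / 2 * ((d t)\<^sup>2 - (r t)\<^sup>2 - (e t)\<^sup>2)"
    using regularized_VI_inner_le[OF h_VI[OF xs_in]]
    by (simp add: d_def r_def e_def norm_minus_commute)
  moreover have "(F (h t) - Ft (h t) (x t)) \<bullet> (h t - xs) \<le> \<gamma> t / 2 * ((\<tau> * r t)\<^sup>2 + (e t)\<^sup>2)"
    using inner_le_young[OF approx_h \<gamma>_nonneg] by (simp add: e_def)
  moreover have "0 \<le> \<mu> * (e t)\<^sup>2" using \<mu> by simp
  ultimately have "0 \<le> \<gamma> t / 2 * ((d t)\<^sup>2 - \<sigma> * (r t)\<^sup>2)"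
    using growth[of t] by (simp add: inner_diff_left \<sigma>_def algebra_simps power_mult_distrib)
  then have "(sqrt \<sigma> * r t)\<^sup>2 \<le> (d t)\<^sup>2"
    using g \<sigma> by (simp add: zero_le_mult_iff power_mult_distrib)
  then show ?thesis by (rule power2_le_imp_le) (simp add: d_def)
qed (simp add: d_def)

text \<open>Here Cauchy-Schwarz replaces Young, so that every term keeps a factor
  \<open>e t\<close>, which is then divided out. The constant \<open>sqrt \<sigma> * c\<close> is
  \<open>(1 + \<tau>) * (L / \<mu>)\<close>.\<close>

lemma e_le: "e t \<le> sqrt \<sigma> * c * r t ^ p"
proof (cases "e t = 0")
  case True
  then show ?thesis using c_pos \<sigma> by (simp add: r_def)
next
  case False
  then have e: "0 < e t" by (simp add: e_def)
  have "Ft (h t) (x t) \<bullet> (h t - xs) \<le> \<gamma> t * ((x t - h t) \<bullet> (h t - xs))"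
    using h_VI[OF xs_in, of t] by (simp add: inner_diff_left inner_diff_right algebra_simps)
  also have "\<dots> \<le> \<gamma> t * (r t * e t)"
    using norm_cauchy_schwarz[of "x t - h t" "h t - xs"] \<gamma>_nonneg
    by (intro mult_left_mono) (auto simp: r_def e_def norm_minus_commute)
  finally have "Ft (h t) (x t) \<bullet> (h t - xs) \<le> \<gamma> t * (r t * e t)" .
  moreover have "(F (h t) - Ft (h t) (x t)) \<bullet> (h t - xs) \<le> \<gamma> t * (\<tau> * r t) * e t"
    using norm_cauchy_schwarz[of "F (h t) - Ft (h t) (x t)" "h t - xs"]
      mult_right_mono[OF approx_h norm_ge_zero, of t "h t - xs"] by (simp add: e_def)
  ultimately have "\<mu> * (e t)\<^sup>2 \<le> \<gamma> t * (1 + \<tau>) * r t * e t"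
    using growth[of t] by (simp add: inner_diff_left algebra_simps)
  then have "\<mu> * e t \<le> \<gamma> t * (1 + \<tau>) * r t"
    using e by (simp add: power2_eq_square)
  then have "e t \<le> \<gamma> t * (1 + \<tau>) * r t / \<mu>"
    using \<mu> by (simp add: pos_le_divide_eq mult.commute)
  also have "\<dots> = sqrt \<sigma> * c * r t ^ p"
    using \<sigma> by (simp add: c_def r_power \<gamma>_def)
  finally show ?thesis .
qed

section \<open>Local phase: convergence of order \<open>p\<close>\<close>

text \<open>The bound is at most \<alpha>, so it also shows that pass \<open>T + m\<close> is local.
  Then \<open>d\<close> at the next pass equals the current \<open>e\<close>, and
  \<open>r_le_d\<close> with \<open>e_le\<close> gives the recursion
  \<open>r (T + Suc m) \<le> c * r (T + m) ^ p\<close>.\<close>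

lemma superlinear:
  assumes "is_local T"
  shows "c * r (T + m) ^ (p - 1) \<le> \<alpha> ^ (p ^ m)"
proof (induction m)
  case 0
  then show ?case using assms by (simp add: is_local_def)
next
  case (Suc m)
  have "\<alpha> ^ (p ^ m) \<le> \<alpha> ^ 1" using \<alpha> p by (intro power_decreasing) auto
  then have "is_local (T + m)" using Suc by (simp add: is_local_def)
  then have "d (T + Suc m) = e (T + m)" by (simp add: local_step d_def e_def)
  then have "sqrt \<sigma> * r (T + Suc m) \<le> sqrt \<sigma> * (c * r (T + m) ^ p)"
    using r_le_d[of "T + Suc m"] e_le[of "T + m"] by (simp add: mult.assoc)
  then have "r (T + Suc m) \<le> c * r (T + m) ^ p" using \<sigma> by simp
  then have "c * r (T + Suc m) ^ (p - 1) \<le> c * (c * r (T + m) ^ p) ^ (p - 1)"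
    using c_pos by (intro mult_left_mono power_mono) (auto simp: r_def)
  also have "\<dots> = c ^ Suc (p - 1) * (r (T + m) ^ (p - 1)) ^ p"
    by (simp add: power_mult_distrib power_mult[symmetric] mult.commute)
  also have "\<dots> = (c * r (T + m) ^ (p - 1)) ^ p"
    using p by (simp add: power_mult_distrib)
  also have "\<dots> \<le> (\<alpha> ^ (p ^ m)) ^ p"
    using Suc c_pos by (intro power_mono) (auto simp: r_def)
  also have "\<dots> = \<alpha> ^ (p ^ Suc m)" by (simp add: power_mult[symmetric] mult.commute)
  finally show ?case .
qed

text \<open>Up to a factor below 1, \<open>e\<close> is bounded by \<open>c * r ^ (p - 1)\<close>
  times \<open>r\<close>. The first is at most \<open>\<epsilon>\<^sup>2\<close>; the second is at
  most \<open>1 / \<epsilon>\<close>, because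
  \<open>\<epsilon> ^ (p - 1) \<le> L / \<mu> \<le> c\<close> and the pass is local.\<close>

lemma local_distance:
  assumes "is_local T" "0 < \<epsilon>" "\<epsilon> \<le> (L / \<mu>) powr (1 / (real p - 1))" "\<alpha> ^ (p ^ m) \<le> \<epsilon>\<^sup>2"
  shows "d (T + m + 1) \<le> \<epsilon>"
proof -
  let ?t = "T + m"
  have "\<alpha> ^ (p ^ m) \<le> \<alpha> ^ 1" using \<alpha> p by (intro power_decreasing) auto
  then have "is_local ?t" using superlinear[OF assms(1), of m] by (simp add: is_local_def)
  then have d: "d (T + m + 1) = e ?t" by (simp add: local_step d_def e_def)
  have s1: "sqrt \<sigma> \<le> 1" using \<sigma> by simp
  have "L / \<mu> \<le> c"
  proof -
    have "1 \<le> (1 + \<tau>) / sqrt \<sigma>" using order_trans[OF s1, of "1 + \<tau>"] \<sigma> \<tau> by simp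
    then have "1 * (L / \<mu>) \<le> (1 + \<tau>) / sqrt \<sigma> * (L / \<mu>)" using L \<mu> by (intro mult_right_mono) auto
    then show ?thesis by (simp add: c_def)
  qed
  have "(\<epsilon> * r ?t) ^ (p - 1) \<le> 1"
  proof -
    have "\<epsilon> ^ (p - 1) \<le> ((L / \<mu>) powr (1 / (real p - 1))) ^ (p - 1)"
      using assms by (intro power_mono) auto
    also have "\<dots> = L / \<mu>"
      using p L \<mu> by (simp add: powr_realpow[symmetric] powr_powr of_nat_diff)
    finally have "\<epsilon> ^ (p - 1) \<le> c" using \<open>L / \<mu> \<le> c\<close> by simp
    then have "(\<epsilon> * r ?t) ^ (p - 1) \<le> c * r ?t ^ (p - 1)"
      by (simp add: power_mult_distrib r_def mult_right_mono)
    then show ?thesis using \<open>is_local ?t\<close> \<alpha> by (simp add: is_local_def)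
  qed
  then have er: "\<epsilon> * r ?t \<le> 1"
    using p one_less_power[of "\<epsilon> * r ?t" "p - 1"] by (meson leD leI zero_less_diff)
  have "e ?t \<le> sqrt \<sigma> * (c * r ?t ^ (p - 1)) * r ?t"
    using e_le[of ?t] by (simp add: r_power mult.assoc)
  also have "\<dots> \<le> 1 * \<epsilon>\<^sup>2 * r ?t"
    using superlinear[OF assms(1), of m] assms(4) s1 c_pos \<sigma>
    by (intro mult_right_mono mult_mono) (auto simp: r_def)
  also have "\<dots> \<le> \<epsilon>" using er \<open>0 < \<epsilon>\<close> by (simp add: power2_eq_square mult.assoc)
  finally show ?thesis using d by simp
qed

section \<open>Global phase: halving the squared distance in each epoch\<close>

text \<open>\<open>F (h t) \<bullet> (h t - xs)\<close> is split at \<open>y t\<close>, and the part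
  from \<open>h t\<close> to \<open>y t\<close> into approximation and error. In the sum the squares
  of \<open>y t - x t\<close> and of \<open>y t - h t\<close> cancel; dividing by
  \<open>\<gamma> t\<close> creates the averaging weight.\<close>

lemma extragradient_step:
  assumes "\<not> is_local t"
  shows "2 * \<mu> * (1 / \<gamma> t * (e t)\<^sup>2) + \<sigma> * (r t)\<^sup>2 \<le> (d t)\<^sup>2 - (norm (y t - xs))\<^sup>2"
proof -
  let ?q = "norm (y t - h t)"
  have y: "y t \<in> X" using nonlocal_step(1)[OF assms] by (simp add: is_arg_min_def)
  have "F (h t) \<bullet> (y t - xs)
      \<le> \<gamma> t / 2 * ((d t)\<^sup>2 - (norm (y t - x t))\<^sup>2 - (norm (y t - xs))\<^sup>2)"
    using regularized_VI_inner_le[OF arg_min_quadratic_VI[OF convex nonlocal_step(1)[OF assms] xs_in]]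
    by (simp add: d_def norm_minus_commute)
  moreover have "Ft (h t) (x t) \<bullet> (h t - y t)
      \<le> \<gamma> t / 2 * ((norm (y t - x t))\<^sup>2 - (r t)\<^sup>2 - ?q\<^sup>2)"
    using regularized_VI_inner_le[OF h_VI[OF y]] by (simp add: r_def)
  moreover have "(F (h t) - Ft (h t) (x t)) \<bullet> (h t - y t) \<le> \<gamma> t / 2 * ((\<tau> * r t)\<^sup>2 + ?q\<^sup>2)"
    using inner_le_young[OF approx_h \<gamma>_nonneg, of t "h t - y t"] by (simp add: norm_minus_commute)
  ultimately have "\<mu> * (e t)\<^sup>2 \<le> \<gamma> t / 2 * ((d t)\<^sup>2 - (norm (y t - xs))\<^sup>2 - \<sigma> * (r t)\<^sup>2)"
    using growth[of t]
    by (simp add: inner_diff_left inner_diff_right \<sigma>_def algebra_simps power_mult_distrib)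
  then show ?thesis using nonlocal_pos(2)[OF assms] by (simp add: field_simps)
qed

definition B :: real where
  "B = (L / \<mu>) powr (2 / (real p + 1)) * (D\<^sup>2 / \<sigma>) powr ((real p - 1) / (real p + 1))"

lemma N_eq: "N = nat \<lceil>B\<rceil>"
  by (simp add: N_def inner_iterations_def B_def \<sigma>_def)

lemma B_pos: "0 < D \<Longrightarrow> 0 < B"
  using L \<mu> \<sigma> by (simp add: B_def)

lemma N_ge: "B \<le> real N"
  by (simp add: N_eq real_nat_ceiling_ge)

lemma N_le: "0 < D \<Longrightarrow> real N \<le> B + 1"
  using B_pos by (simp add: N_eq)

lemma N_pos: "0 < D \<Longrightarrow> 0 < N"
  using B_pos N_ge by (metis less_le_trans of_nat_0_less_iff)

text \<open>The power \<open>p + 1\<close> clears both fractional exponents, so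
  \<open>local_reached\<close> can work with natural powers.\<close>

lemma B_power: "0 < D \<Longrightarrow> B ^ (p + 1) = (L / \<mu>)\<^sup>2 * (D\<^sup>2 / \<sigma>) ^ (p - 1)"
proof -
  assume "0 < D"
  let ?M = "D\<^sup>2 / \<sigma>"
  have "0 < ?M" using \<open>0 < D\<close> \<sigma> by simp
  have exps: "2 / (real p + 1) * real (p + 1) = real 2"
    "(real p - 1) / (real p + 1) * real (p + 1) = real (p - 1)"
    using p by (auto simp: of_nat_diff field_simps add_pos_nonneg)
  have "B ^ (p + 1) = B powr real (p + 1)"
    using B_pos \<open>0 < D\<close> by (simp only: powr_realpow)
  also have "\<dots> = (L / \<mu>) powr real 2 * ?M powr real (p - 1)"
    unfolding B_def by (simp only: powr_mult powr_powr exps powr_ge_zero)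
  also have "\<dots> = (L / \<mu>)\<^sup>2 * ?M ^ (p - 1)"
    using L \<mu> \<open>0 < ?M\<close> by (simp only: powr_realpow divide_pos_pos)
  finally show ?thesis .
qed

text \<open>The choice of \<open>N\<close> makes the power mean bound exactly \<open>1 / \<mu>\<close>.\<close>

lemma sum_inverse_\<gamma>_ge:
  assumes "0 < D" "finite S" "card S = N" "\<And>s. s \<in> S \<Longrightarrow> \<not> is_local s"
    and "(\<Sum>s\<in>S. \<sigma> * (r s)\<^sup>2) \<le> D\<^sup>2"
  shows "1 / \<mu> \<le> (\<Sum>s\<in>S. 1 / \<gamma> s)"
proof -
  \<comment> \<open>The hypothesis controls squares of \<open>r\<close>; with half of
    \<open>p - 1\<close> as exponent, \<open>((r s)\<^sup>2) powr (- a)\<close> is exactly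
    \<open>L / \<gamma> s\<close>.\<close>
  define a where "a = (real p - 1) / 2"
  let ?M = "D\<^sup>2 / \<sigma>"
  have M: "0 < ?M" using assms \<sigma> by simp
  have N: "0 < real N" using N_pos assms by simp
  have a: "0 \<le> a" "1 + a = (real p + 1) / 2" using p by (auto simp: a_def field_simps)
  have "(\<Sum>s\<in>S. (r s)\<^sup>2) \<le> real (card S) * (?M / real N)"
    using assms \<sigma> N by (simp add: sum_distrib_left[symmetric] pos_le_divide_eq mult.commute)
  then have "real (card S) * (?M / real N) powr (- a) \<le> (\<Sum>s\<in>S. ((r s)\<^sup>2) powr (- a))"
    using assms(2) a(1) divide_pos_pos[OF M N] nonlocal_pos(1)[OF assms(4)]
    by (intro power_mean_negative_exponent) (auto simp: less_imp_neq[symmetric])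
  moreover have "((r s)\<^sup>2) powr (- a) = L * (1 / \<gamma> s)" if "s \<in> S" for s
  proof -
    have rs: "0 < r s" using nonlocal_pos assms that by blast
    then have "((r s)\<^sup>2) powr (- a) = (r s powr real 2) powr (- a)"
      by (simp only: powr_realpow)
    also have "\<dots> = inverse (r s powr real (p - 1))"
    proof -
      have "real 2 * a = real (p - 1)" using p by (simp add: a_def of_nat_diff field_simps)
      then show ?thesis by (simp only: powr_powr mult_minus_right powr_minus)
    qed
    also have "\<dots> = L * (1 / \<gamma> s)"
      using rs L by (simp add: powr_realpow \<gamma>_def field_simps del: of_nat_diff)
    finally show ?thesis .
  qed
  ultimately have "real N * (?M / real N) powr (- a) \<le> L * (\<Sum>s\<in>S. 1 / \<gamma> s)"
    using assms by (simp add: sum_distrib_left)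
  moreover have "real N * (?M / real N) powr (- a) = real N powr (1 + a) / ?M powr a"
  proof -
    have "n * (m / n) powr (- a) = n powr (1 + a) / m powr a" if "0 < m" "0 < n" for m n :: real
      using that by (simp add: powr_divide powr_minus powr_add field_simps)
    then show ?thesis using M N .
  qed
  moreover have "L / \<mu> * ?M powr a \<le> real N powr (1 + a)"
  proof -
    have "2 / (real p + 1) * (1 + a) = 1" "(real p - 1) / (real p + 1) * (1 + a) = a"
      using p unfolding a(2) by (simp_all add: a_def field_simps add_pos_nonneg)
    then have "B powr (1 + a) = (L / \<mu>) powr 1 * ?M powr a"
      unfolding B_def by (simp only: powr_mult powr_powr powr_ge_zero)
    then have "L / \<mu> * ?M powr a = B powr (1 + a)"
      using L \<mu> by simp
    also have "\<dots> \<le> real N powr (1 + a)"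
      using N_ge B_pos assms a by (intro powr_mono2) (auto simp: less_imp_le)
    finally show ?thesis .
  qed
  ultimately have "L / \<mu> \<le> L * (\<Sum>s\<in>S. 1 / \<gamma> s)"
    using M by (smt (verit) pos_le_divide_eq powr_gt_zero)
  then have "L * (1 / \<mu>) \<le> L * (\<Sum>s\<in>S. 1 / \<gamma> s)" by simp
  then show ?thesis using L by (simp only: mult_le_cancel_left_pos)
qed

text \<open>Telescoping bounds \<open>2 * \<mu>\<close> times the weighted sum of
  \<open>(e s)\<^sup>2\<close> by \<open>(d t)\<^sup>2\<close>. Jensen moves this to the averaged
  point, and total weight at least \<open>1 / \<mu>\<close> leaves the factor 2.\<close>

lemma epoch:
  assumes "0 < D" "k t = 1" "d t \<le> D" and nonlocal: "\<And>s. t \<le> s \<Longrightarrow> s < t + N \<Longrightarrow> \<not> is_local s"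
  shows "k (t + N) = 1" and "2 * (d (t + N))\<^sup>2 \<le> (d t)\<^sup>2"
proof -
  define G where "G s = 2 * \<mu> * (1 / \<gamma> s * (e s)\<^sup>2) + \<sigma> * (r s)\<^sup>2" for s
  obtain n where n: "N = Suc n" using N_pos \<open>0 < D\<close> gr0_implies_Suc by blast
  have k: "k (t + i) = Suc i" if "i < N" for i
    using that
  proof (induction i)
    case (Suc i)
    with nonlocal_step(5)[of "t + i"] nonlocal[of "t + i"] show ?case by simp
  qed (simp add: assms)
  have sum_G: "(\<Sum>s\<in>{t..<t + i}. G s) + (d (t + i))\<^sup>2 \<le> (d t)\<^sup>2" if "i < N" for i
    using that
  proof (induction i)
    case (Suc i)
    have "\<not> is_local (t + i)" using Suc nonlocal by simp
    moreover from this have "x (Suc (t + i)) = y (t + i)"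
      using nonlocal_step(4)[of "t + i"] k[of i] Suc by simp
    ultimately have "G (t + i) \<le> (d (t + i))\<^sup>2 - (d (t + Suc i))\<^sup>2"
      using extragradient_step[of "t + i"] by (simp add: G_def d_def)
    with Suc show ?case by simp
  qed simp
  let ?S = "{t..<t + N}"
  have last: "\<not> is_local (t + n)" using nonlocal n by simp
  \<comment> \<open>The last pass of the epoch restarts and discards its \<open>y\<close>, so it
    stays outside the telescoping and the distance of that \<open>y\<close> is dropped.\<close>
  have "G (t + n) \<le> (d (t + n))\<^sup>2"
    using extragradient_step[OF last] by (simp add: G_def) (smt (verit) zero_le_power2)
  with sum_G[of n] have "sum G ?S \<le> (d t)\<^sup>2" by (simp add: n)
  moreover have "sum G ?S = 2 * \<mu> * (\<Sum>s\<in>?S. 1 / \<gamma> s * (e s)\<^sup>2) + (\<Sum>s\<in>?S. \<sigma> * (r s)\<^sup>2)"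
    by (simp only: G_def[abs_def] sum.distrib sum_distrib_left)
  ultimately have total:
    "2 * \<mu> * (\<Sum>s\<in>?S. 1 / \<gamma> s * (e s)\<^sup>2) + (\<Sum>s\<in>?S. \<sigma> * (r s)\<^sup>2) \<le> (d t)\<^sup>2"
    by simp
  have dD: "(d t)\<^sup>2 \<le> D\<^sup>2" using assms by (intro power_mono) (auto simp: d_def)
  have "0 \<le> (\<Sum>s\<in>?S. 1 / \<gamma> s * (e s)\<^sup>2)" using \<gamma>_nonneg by (intro sum_nonneg) simp
  then have "0 \<le> 2 * \<mu> * (\<Sum>s\<in>?S. 1 / \<gamma> s * (e s)\<^sup>2)" using \<mu> by simp
  with total dD have "(\<Sum>s\<in>?S. \<sigma> * (r s)\<^sup>2) \<le> D\<^sup>2" by linarith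
  then have \<Gamma>: "1 / \<mu> \<le> (\<Sum>s\<in>?S. 1 / \<gamma> s)"
    using nonlocal by (intro sum_inverse_\<gamma>_ge \<open>0 < D\<close>) auto
  have kN: "k (t + n) = N" using k n by simp
  have S: "{t + n + 1 - N..t + n} = ?S" using n by auto
  show "k (t + N) = 1" using nonlocal_step(3)[OF last kN] by (simp add: n)
  have "x (t + N) = (1 / (\<Sum>s\<in>?S. 1 / \<gamma> s)) *\<^sub>R (\<Sum>s\<in>?S. (1 / \<gamma> s) *\<^sub>R h s)"
    using nonlocal_step(2)[OF last kN] unfolding S by (simp add: n)
  then have "(\<Sum>s\<in>?S. 1 / \<gamma> s) * (d (t + N))\<^sup>2 \<le> (\<Sum>s\<in>?S. 1 / \<gamma> s * (e s)\<^sup>2)"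
    unfolding d_def e_def
    using norm_weighted_mean_le[of ?S "\<lambda>s. 1 / \<gamma> s" h xs] nonlocal nonlocal_pos(2) n by simp
  moreover have "1 / \<mu> * (d (t + N))\<^sup>2 \<le> (\<Sum>s\<in>?S. 1 / \<gamma> s) * (d (t + N))\<^sup>2"
    by (intro mult_right_mono \<Gamma>) simp
  ultimately have "1 / \<mu> * (d (t + N))\<^sup>2 \<le> (\<Sum>s\<in>?S. 1 / \<gamma> s * (e s)\<^sup>2)" by linarith
  then have "2 * \<mu> * (1 / \<mu> * (d (t + N))\<^sup>2) \<le> 2 * \<mu> * (\<Sum>s\<in>?S. 1 / \<gamma> s * (e s)\<^sup>2)"
    using \<mu> by (intro mult_left_mono) auto
  moreover have "0 \<le> (\<Sum>s\<in>?S. \<sigma> * (r s)\<^sup>2)" using \<sigma> by (intro sum_nonneg) simp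
  ultimately have "2 * \<mu> * (1 / \<mu> * (d (t + N))\<^sup>2) \<le> (d t)\<^sup>2" using total by linarith
  then show "2 * (d (t + N))\<^sup>2 \<le> (d t)\<^sup>2" using \<mu> by simp
qed

lemma epochs:
  assumes "0 < D" "\<And>s. s < j * N \<Longrightarrow> \<not> is_local s"
  shows "k (j * N) = 1 \<and> 2 ^ j * (d (j * N))\<^sup>2 \<le> D\<^sup>2"
  using assms(2)
proof (induction j)
  case 0
  have "(d 0)\<^sup>2 \<le> D\<^sup>2" unfolding d_def by (rule power_mono[OF start]) simp
  then show ?case by (simp add: k_0)
next
  case (Suc j)
  then have IH: "k (j * N) = 1" "2 ^ j * (d (j * N))\<^sup>2 \<le> D\<^sup>2" by auto
  \<comment> \<open>The distance never exceeds \<open>D\<close> at a restart, so the same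
    \<open>N\<close>, computed from \<open>D\<close>, serves every epoch.\<close>
  have "1 * (d (j * N))\<^sup>2 \<le> 2 ^ j * (d (j * N))\<^sup>2" by (intro mult_right_mono) auto
  with IH have "(d (j * N))\<^sup>2 \<le> D\<^sup>2" by simp
  then have "d (j * N) \<le> D" using \<open>0 < D\<close> by (auto intro: power2_le_imp_le)
  note ep = epoch[OF \<open>0 < D\<close> IH(1) this]
  have "k (j * N + N) = 1" and half: "2 * (d (j * N + N))\<^sup>2 \<le> (d (j * N))\<^sup>2"
    using ep Suc.prems by (auto simp: add.commute)
  have "2 ^ j * (2 * (d (j * N + N))\<^sup>2) \<le> 2 ^ j * (d (j * N))\<^sup>2"
    by (intro mult_left_mono half) auto
  also note IH(2)
  finally show ?case using \<open>k (j * N + N) = 1\<close> by (simp add: add.commute mult_ac)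
qed

text \<open>Otherwise \<open>j\<close> epochs force \<open>(r ?t)\<^sup>2 * 2 ^ j \<le> ?M\<close>.
  Raised to the power \<open>p - 1\<close> and compared with \<open>B_power\<close>, this makes
  \<open>r ?t\<close> so small that pass \<open>?t\<close> is local after all.\<close>

lemma local_reached:
  assumes "0 < D" and j: "(max 1 B) ^ 3 * ((1 + \<tau>)\<^sup>2 / (\<alpha>\<^sup>2 * \<sigma>)) \<le> 2 ^ j"
  shows "\<exists>T\<le>j * N. is_local T"
proof (rule ccontr)
  assume neg: "\<not> ?thesis"
  define b where "b = max 1 B"
  \<comment> \<open>Chosen so that
    \<open>\<alpha>\<^sup>2 * K * (L / \<mu>)\<^sup>2 = c\<^sup>2\<close>; being at least 1, it is
    bounded by its own power \<open>p - 1\<close>.\<close>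
  define K where "K = (1 + \<tau>)\<^sup>2 / (\<alpha>\<^sup>2 * \<sigma>)"
  let ?t = "j * N" and ?M = "D\<^sup>2 / \<sigma>"
  have K: "1 \<le> K"
  proof -
    have "\<alpha>\<^sup>2 * \<sigma> \<le> 1 * 1" using \<alpha> \<sigma> by (intro mult_mono) (auto simp: power_le_one)
    also have "1 * 1 \<le> (1 + \<tau>)\<^sup>2" using \<tau> by (simp add: one_le_power)
    finally show ?thesis using \<alpha> \<sigma> by (simp add: K_def)
  qed
  have "2 ^ j * (sqrt \<sigma> * r ?t)\<^sup>2 \<le> 2 ^ j * (d ?t)\<^sup>2"
    using r_le_d \<sigma> by (intro mult_left_mono power_mono) (auto simp: r_def)
  also have "\<dots> \<le> D\<^sup>2" using epochs[OF \<open>0 < D\<close>, of j] neg by auto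
  finally have "(r ?t)\<^sup>2 * 2 ^ j \<le> ?M" using \<sigma> by (simp add: power_mult_distrib field_simps)
  then have "((r ?t)\<^sup>2 * 2 ^ j) ^ (p - 1) \<le> ?M ^ (p - 1)" by (intro power_mono) auto
  then have "(L / \<mu>)\<^sup>2 * ((r ?t)\<^sup>2 * 2 ^ j) ^ (p - 1) \<le> (L / \<mu>)\<^sup>2 * ?M ^ (p - 1)"
    by (intro mult_left_mono) auto
  also have "\<dots> = B ^ (p + 1)" using B_power \<open>0 < D\<close> by simp
  also have "\<dots> \<le> b ^ (p + 1)" using B_pos \<open>0 < D\<close> by (intro power_mono) (auto simp: b_def less_imp_le)
  \<comment> \<open>The exponent 3 comes from \<open>p + 1 \<le> 3 * (p - 1)\<close> for
    \<open>p \<ge> 2\<close>, with \<open>b \<ge> 1\<close>.\<close>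
  also have "\<dots> \<le> b ^ (3 * (p - 1))" using p by (intro power_increasing) (auto simp: b_def)
  finally have "K * ((L / \<mu>)\<^sup>2 * ((r ?t)\<^sup>2 * 2 ^ j) ^ (p - 1)) \<le> K * b ^ (3 * (p - 1))"
    using K by (intro mult_left_mono) auto
  also have "\<dots> \<le> K ^ (p - 1) * b ^ (3 * (p - 1))"
    using K p by (intro mult_right_mono) (auto simp: b_def self_le_power)
  also have "\<dots> = (b ^ 3 * K) ^ (p - 1)" by (simp add: power_mult_distrib power_mult mult.commute)
  also have "\<dots> \<le> (2 ^ j) ^ (p - 1)"
    using j K by (intro power_mono) (auto simp: b_def K_def[symmetric])
  finally have "K * (L / \<mu>)\<^sup>2 * ((r ?t)\<^sup>2) ^ (p - 1) * (2 ^ j) ^ (p - 1) \<le> 1 * (2 ^ j) ^ (p - 1)"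
    by (simp add: power_mult_distrib mult_ac)
  then have "K * (L / \<mu>)\<^sup>2 * ((r ?t)\<^sup>2) ^ (p - 1) \<le> 1"
    by (simp only: mult_le_cancel_right_pos zero_less_power zero_less_numeral)
  then have "\<alpha>\<^sup>2 * (K * (L / \<mu>)\<^sup>2 * ((r ?t)\<^sup>2) ^ (p - 1)) \<le> \<alpha>\<^sup>2 * 1"
    by (intro mult_left_mono) auto
  moreover have "\<alpha>\<^sup>2 * K * (L / \<mu>)\<^sup>2 = c\<^sup>2"
    using \<alpha> \<sigma> by (simp add: K_def c_def power_mult_distrib power_divide)
  moreover have "((r ?t)\<^sup>2) ^ (p - 1) = (r ?t ^ (p - 1))\<^sup>2"
    by (simp add: power_mult[symmetric] mult.commute)
  ultimately have "(c * r ?t ^ (p - 1))\<^sup>2 \<le> \<alpha>\<^sup>2"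
    by (simp add: power_mult_distrib mult.assoc[symmetric])
  then have "is_local ?t" using \<alpha> by (auto simp: is_local_def intro: power2_le_imp_le)
  with neg show False by auto
qed

section \<open>Counting the passes\<close>

lemma B_le: "B \<le> first_term p L \<mu> D / \<sigma>"
proof -
  let ?q = "(real p - 1) / (real p + 1)"
  have "(1 / \<sigma>) powr ?q \<le> (1 / \<sigma>) powr 1"
    using \<sigma> p by (intro powr_mono) auto
  then have "(D\<^sup>2) powr ?q * (1 / \<sigma>) powr ?q \<le> (D\<^sup>2) powr ?q * (1 / \<sigma>)"
    using \<sigma> by (intro mult_left_mono) auto
  moreover have "(D\<^sup>2 / \<sigma>) powr ?q = (D\<^sup>2) powr ?q * (1 / \<sigma>) powr ?q"
    using powr_mult[of "D\<^sup>2" "1 / \<sigma>" ?q] \<sigma> by simp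
  ultimately have "(L / \<mu>) powr (2 / (real p + 1)) * (D\<^sup>2 / \<sigma>) powr ?q
      \<le> (L / \<mu>) powr (2 / (real p + 1)) * ((D\<^sup>2) powr ?q * (1 / \<sigma>))"
    by (intro mult_left_mono) auto
  then show ?thesis by (simp add: B_def first_term_def)
qed

text \<open>The number \<open>j\<close> of epochs is logarithmic in \<open>b ^ 3 * K\<close>, and
  each epoch has at most \<open>B + 1\<close> passes. The summand \<open>24 * g\<close> accounts for
  small \<open>A\<close>.\<close>

lemma local_reached_bound:
  fixes A g :: real
  assumes "0 < D"
  defines "A \<equiv> first_term p L \<mu> D" and "g \<equiv> 1 / (\<sigma> * \<alpha>)"
  obtains T where "is_local T" "real T \<le> 24 * (g / \<sigma>) * (A * log 2 (2 + A)) + 24 * g"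
proof -
  define u where "u = 1 / \<sigma>"
  define b where "b = max 1 B"
  define K where "K = (1 + \<tau>)\<^sup>2 / (\<alpha>\<^sup>2 * \<sigma>)"
  define l where "l = log 2 (2 + A)"
  define j where "j = nat \<lceil>log 2 (b ^ 3 * K)\<rceil>"
  have A: "0 \<le> A" by (simp add: A_def first_term_def)
  have u: "1 \<le> u" using \<sigma> by (simp add: u_def)
  have ia: "1 \<le> 1 / \<alpha>" using \<alpha> by simp
  have g: "g = u * (1 / \<alpha>)" by (simp add: g_def u_def)
  have gu: "u \<le> g" unfolding g using mult_left_mono[OF ia, of u] u by simp
  have ga: "1 / \<alpha> \<le> g" unfolding g using mult_right_mono[OF u, of "1 / \<alpha>"] \<alpha> by simp
  have l: "1 \<le> l" using A by (simp add: l_def)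
  have b: "1 \<le> b" by (simp add: b_def)
  have K: "0 < K" using \<alpha> \<sigma> \<tau> by (simp add: K_def)
  have logb: "log 2 b \<le> l + u"
  proof -
    have "b \<le> (2 + A) * u"
    proof -
      have "1 * 1 \<le> (2 + A) * u" using A u by (intro mult_mono) auto
      moreover have "B \<le> A * u" using B_le by (simp add: A_def u_def)
      moreover have "A * u \<le> (2 + A) * u" using u by (intro mult_right_mono) auto
      ultimately show ?thesis by (simp add: b_def)
    qed
    then have "log 2 b \<le> log 2 ((2 + A) * u)" using b by simp
    also have "\<dots> = l + log 2 u" using A u by (simp add: log_mult l_def)
    finally show ?thesis using log_le_self[of 2 u] u by simp
  qed
  have logK: "log 2 K \<le> 2 + u + 2 * (1 / \<alpha>)"
  proof -
    have "K = (1 + \<tau>)\<^sup>2 * (u * (1 / \<alpha>)\<^sup>2)"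
      by (simp add: K_def u_def power_divide)
    then have "log 2 K = 2 * log 2 (1 + \<tau>) + (log 2 u + 2 * log 2 (1 / \<alpha>))"
      using \<tau> u \<alpha> by (simp add: log_mult log_nat_power power_one_over[symmetric] del: power_one_over)
    moreover have "log 2 (1 + \<tau>) \<le> 1" using \<tau> by (simp add: log_le_iff)
    ultimately show ?thesis using log_le_self[of 2 u] log_le_self[of 2 "1 / \<alpha>"] u ia by simp
  qed
  have logbK: "log 2 (b ^ 3 * K) = 3 * log 2 b + log 2 K"
    using b K by (simp add: log_mult log_nat_power)
  have "g \<le> g * l" "l \<le> g * l"
    using mult_left_mono[OF l, of g] mult_right_mono[of 1 g l] gu u l by auto
  \<comment> \<open>The left side is at most \<open>3 * l + 4 * u + 2 * (1 / \<alpha>) + 3\<close>,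
    and each of \<open>l\<close>, \<open>u\<close>, \<open>1 / \<alpha>\<close> and 1 is at most
    \<open>g * l\<close>.\<close>
  then have "3 * log 2 b + log 2 K + 1 \<le> 12 * (g * l)"
    using logb logK gu ga u by linarith
  moreover have "real j \<le> max 0 (3 * log 2 b + log 2 K + 1)"
    unfolding j_def logbK by linarith
  ultimately have j: "real j \<le> 12 * (g * l)" using \<open>g \<le> g * l\<close> gu u by linarith
  have "b ^ 3 * K \<le> 2 ^ j"
  proof -
    have "log 2 (b ^ 3 * K) \<le> real j" unfolding j_def by (rule real_nat_ceiling_ge)
    then show ?thesis using b K by (simp add: log_le_iff powr_realpow)
  qed
  then obtain T where T: "T \<le> j * N" "is_local T"
    using local_reached[OF \<open>0 < D\<close>, of j] by (auto simp: b_def K_def)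
  have lA: "l \<le> A * l + 2"
  proof (cases "1 \<le> A")
    case True
    then have "1 * l \<le> A * l" using l by (intro mult_right_mono) auto
    then show ?thesis by simp
  next
    case False
    then have "l \<le> 2" using A by (simp add: l_def log_le_iff)
    then show ?thesis using A l by (simp add: add_increasing)
  qed
  have "real T \<le> real j * real N" using T by (metis of_nat_mono of_nat_mult)
  also have "\<dots> \<le> 12 * (g * l) * (A * u + 1)"
    using j N_le[OF \<open>0 < D\<close>] B_le gu u l by (intro mult_mono) (auto simp: A_def u_def)
  also have "\<dots> = 12 * (g * u) * (A * l) + 12 * g * l" by (simp add: algebra_simps)
  also have "\<dots> \<le> 12 * (g * u) * (A * l) + 12 * g * (A * l + 2)"
    using lA gu u by (intro add_left_mono mult_left_mono) auto
  also have "\<dots> \<le> 24 * (g * u) * (A * l) + 24 * g"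
  proof -
    have "g * 1 * (A * l) \<le> g * u * (A * l)"
      using gu u A l by (intro mult_right_mono mult_left_mono) auto
    then show ?thesis by (simp add: algebra_simps)
  qed
  finally have "real T \<le> 24 * (g / \<sigma>) * (A * log 2 (2 + A)) + 24 * g"
    by (simp add: u_def l_def)
  with T that show thesis by blast
qed

text \<open>
  The choice of \<open>m\<close> gives \<open>\<alpha> ^ (p ^ m) \<le> \<epsilon>\<^sup>2\<close>, using \<open>1 - \<alpha> \<le> - ln \<alpha>\<close>; one factor \<open>\<epsilon>\<close> is spent on
  \<open>r \<le> (\<mu> / L) powr (1 / (p - 1)) \<le> 1 / \<epsilon>\<close>.
\<close>

lemma superlinear_bound:
  assumes "is_local T" "0 < \<epsilon>" "\<epsilon> \<le> 1 / 4" "\<epsilon> \<le> (L / \<mu>) powr (1 / (real p - 1))"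
  obtains t where "d t \<le> \<epsilon>"
    "real t \<le> real T + log (real p) (log 2 (1 / \<epsilon>)) + 2 / (1 - \<alpha>) + 2"
proof -
  define W where "W = log 2 (1 / \<epsilon>)"
  define m where "m = nat \<lceil>log (real p) (2 * W / (1 - \<alpha>))\<rceil>"
  \<comment> \<open>By \<open>\<epsilon> \<le> 1 / 4\<close>; this keeps
    \<open>log (real p) W\<close> nonnegative, so that truncation by \<open>nat\<close> does no harm
    in the upper bound for \<open>m\<close>.\<close>
  have W: "2 \<le> W" unfolding W_def using assms by (simp add: le_log_iff field_simps)
  have "2 / (1 - \<alpha>) \<ge> 1" using \<alpha> by simp
  have pos: "0 < 2 * W / (1 - \<alpha>)" using W \<alpha> by simp
  have split: "log (real p) (2 * W / (1 - \<alpha>)) = log (real p) W + log (real p) (2 / (1 - \<alpha>))"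
    using log_mult[of "real p" W "2 / (1 - \<alpha>)"] W \<alpha> by (simp add: mult.commute)
  have "0 \<le> log (real p) W" using W p by simp
  moreover have "0 \<le> log (real p) (2 / (1 - \<alpha>))" using \<alpha> p by simp
  moreover have "log (real p) (2 / (1 - \<alpha>)) \<le> 2 / (1 - \<alpha>)"
    using p \<alpha> by (intro log_le_self) auto
  ultimately have m: "real m \<le> log (real p) W + 2 / (1 - \<alpha>) + 1"
    unfolding m_def split by linarith
  have "log (real p) (2 * W / (1 - \<alpha>)) \<le> real m"
    unfolding m_def by (rule real_nat_ceiling_ge)
  then have "2 * W / (1 - \<alpha>) \<le> real p ^ m"
    using pos p by (simp add: log_le_iff powr_realpow)
  then have pm: "2 * W \<le> real (p ^ m) * (1 - \<alpha>)" using \<alpha> by (simp add: field_simps)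
  have "2 * ln (1 / \<epsilon>) \<le> 2 * W"
  proof -
    have "W * ln 2 \<le> W * 1" using W ln_le_minus_one[of "2::real"] by (intro mult_left_mono) auto
    then show ?thesis by (simp add: W_def log_def)
  qed
  also note pm
  also have "real (p ^ m) * (1 - \<alpha>) \<le> real (p ^ m) * (- ln \<alpha>)"
    using ln_le_minus_one[of \<alpha>] \<alpha> by (intro mult_left_mono) auto
  finally have "real (p ^ m) * ln \<alpha> \<le> 2 * ln \<epsilon>" using \<open>0 < \<epsilon>\<close> by (simp add: ln_div)
  then have "ln (\<alpha> ^ (p ^ m)) \<le> ln (\<epsilon>\<^sup>2)" using \<alpha> \<open>0 < \<epsilon>\<close> by (simp add: ln_realpow)
  then have "\<alpha> ^ (p ^ m) \<le> \<epsilon>\<^sup>2" using \<alpha> \<open>0 < \<epsilon>\<close> by (subst (asm) ln_le_cancel_iff) auto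
  then have "d (T + m + 1) \<le> \<epsilon>" using local_distance assms by blast
  with m that[of "T + m + 1"] show thesis by (simp add: W_def)
qed

text \<open>The target has no additive constant, so constants must be absorbed by the double
  logarithm \<open>w\<close>. As \<open>log 2 (1 / \<epsilon>) \<ge> 2\<close>, it is at least
  \<open>log (real p) 2\<close>, hence at least \<open>1 / p\<close>; this costs one factor
  \<open>p\<close>.\<close>

lemma complexity:
  assumes "0 < \<epsilon>" "\<epsilon> \<le> 1 / 4" "\<epsilon> \<le> (L / \<mu>) powr (1 / (real p - 1))"
  shows "\<exists>t. real t \<le> soft_complexity_bound p \<tau> \<alpha> L \<mu> D \<epsilon> \<and> d t \<le> \<epsilon>"
proof -
  define A where "A = first_term p L \<mu> D"
  define w where "w = log (real p) (log 2 (1 / \<epsilon>))"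
  define P where "P = 1 / (\<sigma> * \<alpha>) / \<sigma> / (1 - \<alpha>)"
  define R where "R = A * log 2 (2 + A)"
  have A: "0 \<le> A" by (simp add: A_def first_term_def)
  then have R: "0 \<le> R" by (simp add: R_def)
  have bound: "soft_complexity_bound p \<tau> \<alpha> L \<mu> D \<epsilon> = 100 * (real p)\<^sup>2 * P * (R + w)"
    by (simp add: soft_complexity_bound_def complexity_factor_def A_def w_def P_def R_def \<sigma>_def
        Let_def power2_eq_square)
  have pw: "1 \<le> real p * w"
  proof -
    have lnp: "0 < ln (real p)" using p by simp
    have "log 2 (real p) \<le> real p" using p by (intro log_le_self) auto
    then have "ln (real p) \<le> real p * ln 2" by (simp add: log_def pos_divide_le_eq)
    also have "\<dots> \<le> real p * ln (log 2 (1 / \<epsilon>))"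
    proof (intro mult_left_mono)
      have "2 \<le> log 2 (1 / \<epsilon>)" using assms by (simp add: le_log_iff field_simps)
      then show "ln 2 \<le> ln (log 2 (1 / \<epsilon>))" by simp
    qed simp
    also have "\<dots> = real p * w * ln (real p)" using lnp by (simp add: w_def log_def)
    finally have "1 * ln (real p) \<le> real p * w * ln (real p)" by simp
    then show ?thesis using lnp by (simp only: mult_le_cancel_right_pos)
  qed
  have w: "0 < w" using pw by (metis not_le mult_nonneg_nonpos of_nat_0_le_iff order_trans not_one_le_zero)
  have gP: "1 / (\<sigma> * \<alpha>) / \<sigma> \<le> P" "1 / (\<sigma> * \<alpha>) \<le> P" "1 / (1 - \<alpha>) \<le> P" "1 \<le> P"
  proof -
    have ge: "1 \<le> 1 / \<sigma>" "1 \<le> 1 / (\<sigma> * \<alpha>)" "1 \<le> 1 / (1 - \<alpha>)"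
      using \<sigma> \<alpha> mult_le_one[of \<sigma> \<alpha>] by auto
    have P: "P = 1 / (\<sigma> * \<alpha>) * (1 / \<sigma>) * (1 / (1 - \<alpha>))" by (simp add: P_def)
    have ge2: "1 / (\<sigma> * \<alpha>) * 1 \<le> 1 / (\<sigma> * \<alpha>) * (1 / \<sigma>)"
      using ge \<sigma> \<alpha> by (intro mult_left_mono) auto
    have "1 / (\<sigma> * \<alpha>) * (1 / \<sigma>) * 1 \<le> P"
      unfolding P using ge \<sigma> \<alpha> by (intro mult_left_mono) auto
    then show "1 / (\<sigma> * \<alpha>) / \<sigma> \<le> P" "1 / (\<sigma> * \<alpha>) \<le> P" "1 \<le> P"
      using ge ge2 by auto
    have "1 * (1 / (1 - \<alpha>)) \<le> P"
      unfolding P using ge ge2 \<alpha> by (intro mult_right_mono) auto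
    then show "1 / (1 - \<alpha>) \<le> P" by simp
  qed
  show ?thesis
  \<comment> \<open>For \<open>D = 0\<close> the formula gives \<open>N = 0\<close> and there are no
    epochs to analyze, but the run already starts at the solution.\<close>
  proof (cases "D = 0")
    case True
    then have "d 0 = 0" using start by (simp add: d_def)
    then have "d 0 \<le> \<epsilon>" using \<open>0 < \<epsilon>\<close> by simp
    moreover have "0 \<le> 100 * (real p)\<^sup>2 * P * (R + w)" using R w gP by simp
    ultimately show ?thesis using bound by (intro exI[of _ 0]) simp
  next
    case False
    then have "0 < D" using start norm_ge_zero[of "x 0 - xs"] by linarith
    obtain T where T: "is_local T"
      "real T \<le> 24 * (1 / (\<sigma> * \<alpha>) / \<sigma>) * R + 24 * (1 / (\<sigma> * \<alpha>))"
      using local_reached_bound[OF \<open>0 < D\<close>] by (auto simp: R_def A_def)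
    obtain t where t: "d t \<le> \<epsilon>" "real t \<le> real T + w + 2 / (1 - \<alpha>) + 2"
      using superlinear_bound[OF T(1) assms] by (auto simp: w_def)
    have "24 * (1 / (\<sigma> * \<alpha>) / \<sigma>) * R \<le> 24 * P * R"
      using gP R by (intro mult_right_mono) auto
    \<comment> \<open>28 is 24 from reaching a local pass, 2 from \<open>2 / (1 - \<alpha>)\<close>
      and 2 from the rounding constant.\<close>
    then have "real t \<le> 24 * P * R + 28 * P + w"
      using t(2) T(2) gP by simp
    also have "\<dots> \<le> 100 * (P * R) + 100 * (P * w) + 100 * (real p * w * P)"
    proof -
      have "1 * P \<le> real p * w * P" using pw gP by (intro mult_right_mono) auto
      moreover have "1 * w \<le> P * w" using gP w by (intro mult_right_mono) auto
      moreover have "0 \<le> P * R" using gP R by simp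
      ultimately show ?thesis using gP(4) w by linarith
    qed
    also have "\<dots> \<le> 100 * (real p)\<^sup>2 * P * (R + w)"
    proof -
      \<comment> \<open>The summand \<open>w\<close> itself and the absorbed constants together
        carry \<open>1 + p\<close>; this is where the square of \<open>p\<close> in
        \<open>complexity_factor\<close> is spent.\<close>
      have "1 + real p \<le> (real p)\<^sup>2"
      proof -
        have "2 * real p \<le> real p * real p" using p by (intro mult_right_mono) auto
        moreover have "1 + real p \<le> 2 * real p" using p by simp
        ultimately show ?thesis unfolding power2_eq_square by linarith
      qed
      then have "(1 + real p) * (P * w) \<le> (real p)\<^sup>2 * (P * w)"
        using gP w by (intro mult_right_mono) auto
      moreover have "1 * (P * R) \<le> (real p)\<^sup>2 * (P * R)"
        using gP R p by (intro mult_right_mono) auto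
      ultimately show ?thesis by (simp add: algebra_simps)
    qed
    finally show ?thesis using t(1) bound by auto
  qed
qed

end

theorem theorem4p1:
  fixes X :: "(real ^ 'n) set"
    and F :: "real ^ 'n \<Rightarrow> real ^ 'n"
    and Ft :: "real ^ 'n \<Rightarrow> real ^ 'n \<Rightarrow> real ^ 'n"
    and p :: nat
    and \<tau> \<alpha> L \<mu> D \<epsilon> :: real
    and xs :: "real ^ 'n"
    and k :: "nat \<Rightarrow> nat"
    and x h y :: "nat \<Rightarrow> real ^ 'n"
  assumes "convex X"
    and "p > 1" and "0 < \<tau>" and "\<tau> < 1" and "0 < \<alpha>" and "\<alpha> < 1" and "L > 0"
    and "times_differentiable (p - 1) F"
    and "\<forall>u\<in>X. \<forall>v\<in>X.
           tensor_norm (p - 1) (\<lambda>ds. iter_deriv F ds u - iter_deriv F ds v) \<le> L * norm (u - v)"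
    and "\<mu> > 0" and "strongly_monotone_on X \<mu> F"
    and "VI X F = {xs}"
    and "are_restart_run X F Ft p \<tau> \<alpha> L \<mu> D k x h y"
    and "norm (x 0 - xs) \<le> D"
    and "\<forall>t. \<forall>z\<in>X. norm (Ft z (x t) - F z) \<le> \<tau> * L * norm (z - x t) ^ p"
    and "0 < \<epsilon>" and "\<epsilon> \<le> 1 / 4" and "\<epsilon> \<le> (L / \<mu>) powr (1 / (real p - 1))"
  shows "\<exists>t. real t \<le> soft_complexity_bound p \<tau> \<alpha> L \<mu> D \<epsilon> \<and> norm (x t - xs) \<le> \<epsilon>"
proof -
  interpret restart_run X F Ft p \<tau> \<alpha> L \<mu> D xs k x h y
    using assms by unfold_locales auto
  show ?thesis using complexity assms(16-18) by (simp add: d_def)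
qed

end
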